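(* Let $\phi$ be built from a function $\rho:[0,\infty)\to\mathbb{R}$ (as in the context) such that: (R1) $\rho$ is bounded and continuously differentiable with bounded derivative $\psi=\rho'$, and $\rho(0)=0$; (R2) $\psi(t)\ge 0$ for all $t\geq 0$ and there exists some $c\ge \log 2$ such that $\psi(t)>0$ for all $0<t<c$. Assume furthermore that: (H1) for all $\alpha\in\mathbb{R}^p$, $\alpha\ne 0$, $\mathbb{P}(x^{T}\alpha=0)=0$; (H2) $w$ is a non-negative bounded function with support $\mathcal{C}_w$ such that $\mathbb{P}(x\in\mathcal{C}_w)>0$ (and, without loss of generality, $\|w\|_\infty=1$). If $I_{\lambda_n}(\beta_0)\to 0$ almost surely as $n\to\infty$, then the penalized estimator $\widehat\beta_n$ is strongly consistent for $\beta_0$, i.e. $\widehat\beta_n\to\beta_0$ almost surely.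
   Context: Model: $p\ge1$ is fixed; $(y_i,x_i)$, $i\ge 1$, are i.i.d. copies of $(y,x)$ with $x\in\mathbb{R}^p$, $y\in\{0,1\}$ and $\mathbb{P}(y=1\mid x)=F(x^{T}\beta_0)$, where $F(t)=e^t/(1+e^t)$ and $\beta_0\in\mathbb{R}^p$. Loss: given $\rho:[0,\infty)\to\mathbb{R}$ with derivative $\psi=\rho'$, put $$\phi(y,t)=y\,\rho(-\log F(t))+(1-y)\,\rho(-\log(1-F(t)))+G(F(t))+G(1-F(t)),\qquad G(t)=\int_0^t\psi(-\log u)\,du .$$ Weight: $w$ is a real-valued weight function on $\mathbb{R}^p$. Penalty: $I_\lambda$ is a penalty function on $\mathbb{R}^p$, chosen by the user, depending on a tuning parameter $\lambda$; $\lambda_n$ is a sequence of tuning parameters, which may be deterministic or random. Estimator: $L_n(\beta)=\frac1n\sum_{i=1}^n\phi(y_i,x_i^{T}\beta)\,w(x_i)$ and $\widehat\beta_n=\operatorname{argmin}_{\beta\in\mathbb{R}^p}\{L_n(\beta)+I_{\lambda_n}(\beta)\}$.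
   Formalization: The penalty function is assumed non-negative (a penalty very negative at one wrong point would make the claim false), and the support of w is read as the set where w is non-zero, without closure; w is Borel measurable. *)

theory Defs
  imports "HOL-Probability.Probability"
begin

definition logistic :: "real \<Rightarrow> real" where
  "logistic t = exp t / (1 + exp t)"

text \<open>Only used for \<open>0 \<le> t \<le> 1\<close>, where \<open>- ln u \<ge> 0\<close> on \<open>{0<..t}\<close>; the value of the
  integrand at the single point \<open>u = 0\<close> is irrelevant. For continuous bounded \<open>\<psi>\<close> the integral exists.\<close>

definition G_corr :: "(real \<Rightarrow> real) \<Rightarrow> real \<Rightarrow> real" where
  "G_corr \<psi> t = integral {0..t} (\<lambda>u. \<psi> (- ln u))"

definition phi :: "(real \<Rightarrow> real) \<Rightarrow> (real \<Rightarrow> real) \<Rightarrow> real \<Rightarrow> real \<Rightarrow> real" where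
  "phi \<rho> \<psi> y t =
     y * \<rho> (- ln (logistic t)) + (1 - y) * \<rho> (- ln (1 - logistic t))
     + G_corr \<psi> (logistic t) + G_corr \<psi> (1 - logistic t)"

text \<open>The functions \<open>\<rho>\<close> and \<open>\<psi>\<close> live on \<open>[0,\<infinity>)\<close>: nothing is required of them on negative arguments,
  and the derivative at \<open>0\<close> is one-sided.\<close>

definition cond_R1 :: "(real \<Rightarrow> real) \<Rightarrow> (real \<Rightarrow> real) \<Rightarrow> bool" where
  "cond_R1 \<rho> \<psi> \<longleftrightarrow>
     (\<forall>t\<ge>0. (\<rho> has_real_derivative \<psi> t) (at t within {0..})) \<and>
     continuous_on {0..} \<psi> \<and> bounded (\<rho> ` {0..}) \<and> bounded (\<psi> ` {0..}) \<and> \<rho> 0 = 0"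

definition cond_R2 :: "(real \<Rightarrow> real) \<Rightarrow> bool" where
  "cond_R2 \<psi> \<longleftrightarrow> (\<forall>t\<ge>0. \<psi> t \<ge> 0) \<and> (\<exists>c\<ge>ln 2. \<forall>t. 0 < t \<and> t < c \<longrightarrow> \<psi> t > 0)"

definition emp_loss ::
  "(real \<Rightarrow> real) \<Rightarrow> (real \<Rightarrow> real) \<Rightarrow> (real ^ 'p \<Rightarrow> real) \<Rightarrow>
   (nat \<Rightarrow> real) \<Rightarrow> (nat \<Rightarrow> real ^ 'p) \<Rightarrow> nat \<Rightarrow> real ^ 'p \<Rightarrow> real" where
  "emp_loss \<rho> \<psi> w y x n \<beta> = (1 / real n) * (\<Sum>i=1..n. phi \<rho> \<psi> (y i) (x i \<bullet> \<beta>) * w (x i))"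

text \<open>The minimiser need not be unique; an estimate is any global minimiser.\<close>

definition is_penalized_estimate ::
  "(real \<Rightarrow> real) \<Rightarrow> (real \<Rightarrow> real) \<Rightarrow> (real ^ 'p \<Rightarrow> real) \<Rightarrow> (real ^ 'p \<Rightarrow> real) \<Rightarrow>
   (nat \<Rightarrow> real) \<Rightarrow> (nat \<Rightarrow> real ^ 'p) \<Rightarrow> nat \<Rightarrow> real ^ 'p \<Rightarrow> bool" where
  "is_penalized_estimate \<rho> \<psi> w pen y x n b \<longleftrightarrow>
     is_arg_min (\<lambda>\<beta>. emp_loss \<rho> \<psi> w y x n \<beta> + pen \<beta>) (\<lambda>_. True) b"

text \<open>The covariate and response space is \<open>real \<times> real ^ 'p\<close> with its Borel sets; the binary response is
  coded as a real number, and \<open>\<P>(y = 1 | x)\<close> is the conditional expectation of the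
  indicator of \<open>y = 1\<close> given the sigma-algebra generated by \<open>x\<close>.\<close>

definition logistic_model ::
  "'a measure \<Rightarrow> ('a \<Rightarrow> real) \<Rightarrow> ('a \<Rightarrow> real ^ 'p) \<Rightarrow> real ^ 'p \<Rightarrow> bool" where
  "logistic_model M y x \<beta>\<^sub>0 \<longleftrightarrow>
     y \<in> borel_measurable M \<and> x \<in> borel_measurable M \<and>
     (AE \<omega> in M. y \<omega> \<in> {0, 1}) \<and>
     (AE \<omega> in M. real_cond_exp M (vimage_algebra (space M) x borel)
                   (indicator {\<omega> \<in> space M. y \<omega> = 1}) \<omega> = logistic (x \<omega> \<bullet> \<beta>\<^sub>0))"

definition iid_copies ::
  "'a measure \<Rightarrow> (nat \<Rightarrow> 'a \<Rightarrow> real) \<Rightarrow> (nat \<Rightarrow> 'a \<Rightarrow> real ^ 'p) \<Rightarrow>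
   ('a \<Rightarrow> real) \<Rightarrow> ('a \<Rightarrow> real ^ 'p) \<Rightarrow> bool" where
  "iid_copies M ys xs y x \<longleftrightarrow>
     prob_space.indep_vars M (\<lambda>_. borel) (\<lambda>i \<omega>. (ys i \<omega>, xs i \<omega>)) {1..} \<and>
     (\<forall>i\<ge>1. distr M borel (\<lambda>\<omega>. (ys i \<omega>, xs i \<omega>)) = distr M borel (\<lambda>\<omega>. (y \<omega>, x \<omega>)))"

definition cond_H1 :: "'a measure \<Rightarrow> ('a \<Rightarrow> real ^ 'p) \<Rightarrow> bool" where
  "cond_H1 M x \<longleftrightarrow> (\<forall>\<alpha>. \<alpha> \<noteq> 0 \<longrightarrow> measure M {\<omega> \<in> space M. x \<omega> \<bullet> \<alpha> = 0} = 0)"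

text \<open>The support of \<open>w\<close> is the set where \<open>w\<close> does not vanish, without taking the closure (with the
  closure, \<open>w\<close> could vanish almost surely at \<open>x\<close>). The normalisation of the supremum norm of \<open>w\<close>
  to \<open>1\<close>, being without loss of generality, is not imposed.\<close>

definition cond_H2 :: "'a measure \<Rightarrow> ('a \<Rightarrow> real ^ 'p) \<Rightarrow> (real ^ 'p \<Rightarrow> real) \<Rightarrow> bool" where
  "cond_H2 M x w \<longleftrightarrow>
     w \<in> borel_measurable borel \<and> (\<forall>v. w v \<ge> 0) \<and> bounded (range w) \<and>
     measure M {\<omega> \<in> space M. x \<omega> \<in> {v. w v \<noteq> 0}} > 0"

end

theory Submission
  imports Defs "HOL-Real_Asymp.Real_Asymp"
begin

text \<open>
  Let \<open>B = \<phi>(0, \<cdot>)\<close>. Then \<open>\<phi>(1, t) = B (- t)\<close> and \<open>B' = F D\<close> with \<open>D\<close> even, nonnegative, and positive off \<open>0\<close>,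
  so the conditional risk \<open>F s * B (- t) + (1 - F s) * B t\<close> has derivative \<open>(F t - F s) D t\<close> in \<open>t\<close>
  and its unique minimum, even over \<open>t \<in> [-\<infinity>, \<infinity>]\<close>, at \<open>t = s\<close>. Consistency follows by Wald's
  argument: every \<open>\<beta> \<noteq> \<beta>\<^sub>0\<close> and every direction at infinity has a neighbourhood on which
  \<open>\<phi>(y, x \<bullet> \<beta>) w(x)\<close> is bounded below by one bounded function of \<open>(y, x)\<close> with expectation above the
  risk of \<open>\<beta>\<^sub>0\<close>. By the strong law the minimiser eventually leaves that neighbourhood, and
  compactness of the sphere and of bounded closed sets leaves finitely many neighbourhoods.
  Since \<open>B\<close> is monotone and bounded, these lower bounds are explicit, and the strong law is only needed
  for bounded variables, where Hoeffding's inequality and the Borel--Cantelli lemma yield it.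
\<close>

section \<open>A strong law for bounded variables\<close>

text \<open>Hoeffding's inequality bounds the probability that the mean of \<open>n\<close> terms
  deviates by \<epsilon> by \<open>2 * q ^ n\<close> with \<open>q < 1\<close>. This is summable, so
  by Borel--Cantelli almost surely only finitely many such deviations occur.\<close>

lemma (in prob_space) slln_bounded:
  fixes X :: "nat \<Rightarrow> 'a \<Rightarrow> real"
  assumes indep: "indep_vars (\<lambda>_. borel) X {1..}"
    and distr: "\<And>i. i \<ge> 1 \<Longrightarrow> distr M borel (X i) = distr M borel Y"
    and [measurable]: "Y \<in> borel_measurable M"
    and bound: "AE \<omega> in M. \<bar>Y \<omega>\<bar> \<le> C"
  shows "AE \<omega> in M. (\<lambda>n. (\<Sum>i=1..n. X i \<omega>) / real n) \<longlonglongrightarrow> expectation Y"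
proof -
  \<comment> \<open>The added \<open>1\<close> keeps \<open>{- b..b}\<close> nondegenerate when
    \<open>C = 0\<close>, so that \<open>q < 1\<close> below.\<close>
  define b where "b = \<bar>C\<bar> + 1"
  have X_meas: "X i \<in> borel_measurable M" if "i \<ge> 1" for i
    using indep that unfolding indep_vars_def by auto
  have meas: "(\<lambda>\<omega>. \<Sum>i=1..n. X i \<omega>) \<in> borel_measurable M" for n
    by (intro borel_measurable_sum X_meas) auto
  have dev: "AE \<omega> in M. \<forall>\<^sub>F n in sequentially. \<bar>(\<Sum>i=1..n. X i \<omega>) / real n - expectation Y\<bar> < \<epsilon>"
    if "\<epsilon> > 0" for \<epsilon> :: real
  proof -
    let ?A = "\<lambda>n. {\<omega> \<in> space M. \<bar>(\<Sum>i=1..n. X i \<omega>) / real n - expectation Y\<bar> \<ge> \<epsilon>}"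
    define q where "q = exp (- 2 * \<epsilon>\<^sup>2 / (b - - b)\<^sup>2)"
    have sets: "?A n \<in> sets M" for n
      using meas by measurable
    have q: "0 < q" "q < 1"
      using that by (auto simp: q_def b_def divide_simps)
    have le: "prob (?A n) \<le> 2 * q ^ n" if n: "n \<ge> 1" for n
    proof -
      interpret H: Hoeffding_ineq_iid M "{1..n}" X Y "- b" b "expectation Y"
      proof unfold_locales
        show "indep_vars (\<lambda>_. borel) X {1..n}"
          by (rule indep_vars_subset[OF indep]) auto
        show "AE \<omega> in M. Y \<omega> \<in> {- b..b}"
          using bound by eventually_elim (auto simp: b_def)
      qed (auto simp: distr)
      have ge: "prob {\<omega> \<in> space M. (\<Sum>i=1..n. X i \<omega>) / real n \<ge> expectation Y + \<epsilon>} \<le> q ^ n"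
        and le: "prob {\<omega> \<in> space M. (\<Sum>i=1..n. X i \<omega>) / real n \<le> expectation Y - \<epsilon>} \<le> q ^ n"
        using H.Hoeffding_ineq_ge'[of \<epsilon>] H.Hoeffding_ineq_le'[of \<epsilon>] n \<open>\<epsilon> > 0\<close>
        by (auto simp: q_def b_def exp_of_nat_mult [symmetric] mult_ac)
      have "prob (?A n) \<le> prob ({\<omega> \<in> space M. (\<Sum>i=1..n. X i \<omega>) / real n \<ge> expectation Y + \<epsilon>}
          \<union> {\<omega> \<in> space M. (\<Sum>i=1..n. X i \<omega>) / real n \<le> expectation Y - \<epsilon>})"
        using meas[of n] by (intro finite_measure_mono) (auto simp: abs_if split: if_splits)
      also have "\<dots> \<le> q ^ n + q ^ n"
        using meas[of n] by (intro order.trans[OF measure_Un_le] add_mono ge le) measurable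
      finally show ?thesis by simp
    qed
    have "summable (\<lambda>n. prob (?A n))"
    proof (rule summable_comparison_test_ev)
      show "\<forall>\<^sub>F n in sequentially. norm (prob (?A n)) \<le> 2 * q ^ n"
        using eventually_ge_at_top[of 1] by eventually_elim (use le in auto)
      show "summable (\<lambda>n. 2 * q ^ n)"
        using q by (intro summable_mult summable_geometric) auto
    qed
    then have "AE \<omega> in M. \<forall>\<^sub>F n in sequentially. \<omega> \<in> space M - ?A n"
      by (intro borel_cantelli_AE1 sets) (auto simp: emeasure_eq_measure)
    then show ?thesis
      by eventually_elim (auto elim: eventually_mono)
  qed
  \<comment> \<open>Only countably many null sets may be united, hence the tolerances
    \<open>1 / real (Suc k)\<close>.\<close>
  have "AE \<omega> in M. \<forall>k. \<forall>\<^sub>F n in sequentially.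
      \<bar>(\<Sum>i=1..n. X i \<omega>) / real n - expectation Y\<bar> < 1 / real (Suc k)"
    by (subst AE_all_countable, intro allI dev) simp
  then show ?thesis
  proof eventually_elim
    case (elim \<omega>)
    show ?case
    proof (rule tendstoI)
      fix \<epsilon> :: real assume "\<epsilon> > 0"
      then obtain k where k: "1 / real (Suc k) < \<epsilon>"
        using nat_approx_posE by blast
      show "\<forall>\<^sub>F n in sequentially. dist ((\<Sum>i=1..n. X i \<omega>) / real n) (expectation Y) < \<epsilon>"
        using elim[rule_format, of k] by eventually_elim (use k in \<open>auto simp: dist_real_def\<close>)
    qed
  qed
qed

section \<open>The loss function\<close>

lemma logistic_pos: "0 < logistic t" and logistic_less_1: "logistic t < 1"
  by (auto simp: logistic_def add_pos_pos divide_simps)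

lemma logistic_minus: "logistic (- t) = 1 - logistic t"
  using add_pos_pos[OF exp_gt_zero[of t] zero_less_one]
  by (simp add: logistic_def exp_minus field_simps)

lemma logistic_measurable [measurable]: "logistic \<in> borel_measurable borel"
  unfolding logistic_def by measurable

lemma logistic_deriv:
  "(logistic has_real_derivative logistic t * (1 - logistic t)) (at t)"
proof -
  have "1 + exp t \<noteq> 0" using exp_gt_zero[of t] by linarith
  then show ?thesis
    unfolding logistic_def[abs_def]
    by (auto intro!: derivative_eq_intros simp: divide_simps) (simp add: algebra_simps power2_eq_square)
qed

lemma logistic_less_half_iff: "logistic t < 1 / 2 \<longleftrightarrow> t < 0"
  using exp_gt_zero[of t] exp_less_one_iff[of t]
  by (simp add: logistic_def divide_simps add_pos_pos)

lemma logistic_strict_mono: "s < t \<Longrightarrow> logistic s < logistic t"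
  by (simp add: logistic_def divide_simps add_pos_pos) (simp add: algebra_simps)

section \<open>Conditional risk and its limits at infinity\<close>

text \<open>\<open>B t\<close> stands for the loss under label 0 and \<open>B (- t)\<close> for the
  loss under label 1, so \<open>risk_strict\<close> speaks of the conditional risk of predicting
  \<open>t\<close> when the truth is \<open>s\<close>. It gives growth to the right of
  \<open>s\<close>; reflection supplies the left side. Growth is asked for, rather than a strict
  minimum at \<open>s\<close>, because the minimum must also be strict against the limits at
  infinity.\<close>

locale fisher_loss =
  fixes B :: "real \<Rightarrow> real" and C :: real
  assumes cont: "continuous_on UNIV B"
    and mono: "mono B"
    and bound: "\<bar>B t\<bar> \<le> C"
    and risk_strict: "s \<le> t \<Longrightarrow> t < u \<Longrightarrow>
      logistic s * B (- t) + (1 - logistic s) * B t < logistic s * B (- u) + (1 - logistic s) * B u"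
begin

lemma risk_min:
  assumes "s \<noteq> t"
  shows "logistic s * B (- s) + (1 - logistic s) * B s < logistic s * B (- t) + (1 - logistic s) * B t"
proof (cases "s < t")
  case True
  then show ?thesis using risk_strict[of s s t] by simp
next
  case False
  \<comment> \<open>Replacing \<open>s\<close>, \<open>t\<close> by \<open>- s\<close>,
    \<open>- t\<close> swaps \<open>logistic s\<close> with \<open>1 - logistic s\<close> and so
    preserves the risk.\<close>
  then show ?thesis
    using risk_strict[of "- s" "- s" "- t"] assms by (simp add: logistic_minus)
qed

lemma bdd: "bdd_above (range B)" "bdd_below (range B)"
  using bound by (auto simp: abs_le_iff intro!: bdd_aboveI[of _ C] bdd_belowI[of _ "- C"])
    (metis minus_le_iff)

text \<open>By monotonicity these are the limits of \<open>B\<close> at plus and minus infinity, the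
  losses of predictors that escape to infinity.\<close>

definition B_top :: real where "B_top = Sup (range B)"
definition B_bot :: real where "B_bot = Inf (range B)"

lemma B_bot_le: "B_bot \<le> B t" and le_B_top: "B t \<le> B_top"
  using bdd by (auto simp: B_bot_def B_top_def intro: cINF_lower cSUP_upper)

lemma abs_B_bot_le: "\<bar>B_bot\<bar> \<le> C"
proof -
  have "- C \<le> B_bot"
    unfolding B_bot_def using bound by (intro cINF_greatest) (auto simp: abs_le_iff minus_le_iff)
  moreover have "B_bot \<le> C"
    using B_bot_le[of 0] bound[of 0] by linarith
  ultimately show ?thesis by linarith
qed

lemma tendsto_B_top: "(B \<longlongrightarrow> B_top) at_top"
proof (rule order_tendstoI)
  fix a assume "a < B_top"
  then obtain t where t: "a < B t"
    unfolding B_top_def using less_cSUP_iff[OF _ bdd(1)] by auto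
  show "\<forall>\<^sub>F s in at_top. a < B s"
    using eventually_ge_at_top[of t]
    by eventually_elim (use t monoD[OF mono] in \<open>force\<close>)
qed (use le_B_top in \<open>auto intro: always_eventually le_less_trans\<close>)

lemma tendsto_B_bot: "(B \<longlongrightarrow> B_bot) at_bot"
proof (rule order_tendstoI)
  fix a assume "B_bot < a"
  then obtain t where t: "B t < a"
    unfolding B_bot_def using cINF_less_iff[OF _ bdd(2)] by auto
  show "\<forall>\<^sub>F s in at_bot. B s < a"
    using eventually_le_at_bot[of t]
    by eventually_elim (use t monoD[OF mono] in \<open>force\<close>)
qed (use B_bot_le in \<open>auto intro: always_eventually less_le_trans\<close>)

text \<open>The right side is the limit of the risk as \<open>t\<close> tends to plus infinity.
  Limits preserve only weak inequalities, so the strict gain is secured between \<open>s\<close> and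
  \<open>s + 1\<close> first.\<close>

lemma risk_less_risk_top:
  "logistic s * B (- s) + (1 - logistic s) * B s < logistic s * B_bot + (1 - logistic s) * B_top"
proof -
  let ?h = "\<lambda>t. logistic s * B (- t) + (1 - logistic s) * B t"
  have "?h s < ?h (s + 1)"
    by (rule risk_min) simp
  also have "?h (s + 1) \<le> logistic s * B_bot + (1 - logistic s) * B_top"
  proof (rule tendsto_lowerbound)
    show "(?h \<longlongrightarrow> logistic s * B_bot + (1 - logistic s) * B_top) at_top"
      by (intro tendsto_intros tendsto_B_top filterlim_compose[OF tendsto_B_bot]
          filterlim_uminus_at_bot_at_top)
    show "\<forall>\<^sub>F t in at_top. ?h (s + 1) \<le> ?h t"
      using eventually_gt_at_top[of "s + 1"]
      by eventually_elim (use risk_strict[of s "s + 1"] in \<open>auto intro: less_imp_le\<close>)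
  qed simp
  finally show ?thesis .
qed

lemma risk_less_risk_bot:
  "logistic s * B (- s) + (1 - logistic s) * B s < logistic s * B_top + (1 - logistic s) * B_bot"
  using risk_less_risk_top[of "- s"] by (simp add: logistic_minus)

end

section \<open>Derivative, boundedness and Fisher consistency of the loss\<close>

text \<open>The integrand need not have a limit at \<open>0\<close>, so continuity is used on the
  open interval only; there it is bounded and measurable, and the endpoints form a null set.\<close>

lemma integrable_on_psi_log:
  fixes \<psi> :: "real \<Rightarrow> real"
  assumes cont: "continuous_on {0..} \<psi>" and bound: "\<And>t. 0 \<le> t \<Longrightarrow> \<bar>\<psi> t\<bar> \<le> K"
  shows "(\<lambda>u. \<psi> (- ln u)) integrable_on {0..(1::real)}"
proof -
  have "continuous_on {0<..<1} (\<lambda>u. \<psi> (- ln u))"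
    by (intro continuous_on_compose2[OF cont] continuous_intros) auto
  then have "(\<lambda>u. \<psi> (- ln u)) \<in> borel_measurable (lebesgue_on {0<..<1})"
    by (intro continuous_imp_measurable_on_sets_lebesgue) auto
  then have "(\<lambda>u. \<psi> (- ln u)) integrable_on {0<..<1}"
    by (rule measurable_bounded_by_integrable_imp_integrable[where g = "\<lambda>_. K"])
      (auto intro!: bound integrable_on_const)
  then show ?thesis
    by (simp add: integrable_on_open_interval_real)
qed

text \<open>The fundamental theorem of calculus at an interior point: \<open>0 < t\<close> avoids
  the possible discontinuity at \<open>0\<close>, and \<open>t < 1\<close> keeps
  \<open>- ln u\<close> in the domain of \<psi> for \<open>u\<close> near \<open>t\<close>.\<close>

lemma G_corr_deriv:
  fixes \<psi> :: "real \<Rightarrow> real"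
  assumes cont: "continuous_on {0..} \<psi>" and bound: "\<And>t. 0 \<le> t \<Longrightarrow> \<bar>\<psi> t\<bar> \<le> K"
    and t: "0 < t" "t < 1"
  shows "(G_corr \<psi> has_real_derivative \<psi> (- ln t)) (at t)"
proof -
  have c: "continuous_on {0<..<1} (\<lambda>u. \<psi> (- ln u))"
    by (intro continuous_on_compose2[OF cont] continuous_intros) auto
  then have c: "isCont (\<lambda>u. \<psi> (- ln u)) t"
    using t by (simp add: continuous_on_eq_continuous_at)
  have "((\<lambda>u. integral {0..u} (\<lambda>u. \<psi> (- ln u))) has_vector_derivative \<psi> (- ln t)) (at t within {0..1} - {})"
    by (rule integral_has_vector_derivative_continuous_at[OF integrable_on_psi_log[OF cont bound]])
      (use t c in \<open>auto intro: continuous_at_imp_continuous_at_within\<close>)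
  then have "(G_corr \<psi> has_real_derivative \<psi> (- ln t)) (at t within {0..1})"
    by (simp add: has_real_derivative_iff_has_vector_derivative G_corr_def[abs_def])
  moreover have "at t within {0..1} = at t"
    using t by (intro at_within_interior) auto
  ultimately show ?thesis by simp
qed

lemma abs_G_corr_le:
  fixes \<psi> :: "real \<Rightarrow> real"
  assumes cont: "continuous_on {0..} \<psi>" and bound: "\<And>t. 0 \<le> t \<Longrightarrow> \<bar>\<psi> t\<bar> \<le> K"
    and t: "0 \<le> t" "t \<le> 1"
  shows "\<bar>G_corr \<psi> t\<bar> \<le> K"
proof -
  have "(\<lambda>u. \<psi> (- ln u)) integrable_on {0..t}"
    by (rule integrable_subinterval_real[OF integrable_on_psi_log[OF cont bound]]) (use t in auto)
  \<comment> \<open>At \<open>u = 0\<close> the convention \<open>ln 0 = 0\<close> makes the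
    integrand \<open>\<psi> 0\<close>, which \<open>K\<close> bounds as well.\<close>
  moreover have "\<bar>\<psi> (- ln u)\<bar> \<le> K" if "u \<in> {0..t}" for u
    using that t by (cases "u = 0") (auto intro!: bound)
  ultimately have "norm (G_corr \<psi> t) \<le> integral {0..t} (\<lambda>_. K)"
    unfolding G_corr_def by (intro integral_norm_bound_integral) auto
  also have "\<dots> = t * K" using t by simp
  also have "\<dots> \<le> 1 * K"
    using t bound[of 0] by (intro mult_right_mono) auto
  finally show ?thesis by simp
qed

text \<open>Reflection swaps \<open>logistic t\<close> and \<open>1 - logistic t\<close>: the
  \<rho>-terms trade places and the sum of the two \<open>G_corr\<close> terms is unchanged. So one
  function describes both labels.\<close>

lemma phi_1_eq: "phi \<rho> \<psi> 1 t = phi \<rho> \<psi> 0 (- t)"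
  by (simp add: phi_def logistic_minus)

text \<open>With \<open>F = logistic t\<close>, the \<rho>-term contributes
  \<open>\<psi> (- ln (1 - F)) * F\<close> and the correction terms contribute
  \<open>F * (1 - F)\<close> times \<open>\<psi> (- ln F) - \<psi> (- ln (1 - F))\<close>. The
  correction turns the sum into \<open>F\<close> times an even function of \<open>t\<close>, the
  source of Fisher consistency.\<close>

lemma phi_0_deriv:
  assumes R1: "cond_R1 \<rho> \<psi>"
  shows "(phi \<rho> \<psi> 0 has_real_derivative
    logistic t * (\<psi> (- ln (logistic t)) * (1 - logistic t) + \<psi> (- ln (1 - logistic t)) * logistic t)) (at t)"
proof -
  let ?F = "logistic t"
  obtain K where K: "\<And>t. 0 \<le> t \<Longrightarrow> \<bar>\<psi> t\<bar> \<le> K"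
    using R1 by (auto simp: cond_R1_def bounded_iff)
  have F: "0 < ?F" "?F < 1"
    by (rule logistic_pos logistic_less_1)+
  \<comment> \<open>The derivative of \<rho> at \<open>0\<close> is only one-sided; strict
    positivity places the argument in the interior, where it is two-sided.\<close>
  have pos: "0 < - ln (1 - ?F)"
    using F by simp
  have "(\<rho> has_real_derivative \<psi> (- ln (1 - ?F))) (at (- ln (1 - ?F)) within {0..})"
    using R1 pos by (auto simp: cond_R1_def)
  moreover have "at (- ln (1 - ?F)) within {0..} = at (- ln (1 - ?F))"
    using pos by (intro at_within_interior) (simp add: interior_real_atLeast)
  ultimately have \<rho>: "(\<rho> has_real_derivative \<psi> (- ln (1 - ?F))) (at (- ln (1 - ?F)))"
    by simp
  have G: "(G_corr \<psi> has_real_derivative \<psi> (- ln s)) (at s)" if "0 < s" "s < 1" for s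
    by (rule G_corr_deriv[OF _ K that]) (use R1 in \<open>auto simp: cond_R1_def\<close>)
  have comp: "((\<lambda>t. - ln (1 - logistic t)) has_real_derivative ?F) (at t)"
    by (rule derivative_eq_intros logistic_deriv | use F in simp)+
  have comp': "((\<lambda>t. 1 - logistic t) has_real_derivative - (?F * (1 - ?F))) (at t)"
    by (rule derivative_eq_intros logistic_deriv | simp)+
  have "((\<lambda>t. \<rho> (- ln (1 - logistic t)) + G_corr \<psi> (logistic t) + G_corr \<psi> (1 - logistic t))
    has_real_derivative \<psi> (- ln (1 - ?F)) * ?F + \<psi> (- ln ?F) * (?F * (1 - ?F))
      + \<psi> (- ln (1 - ?F)) * - (?F * (1 - ?F))) (at t)"
    using F by (intro DERIV_add DERIV_chain2[OF \<rho> comp] DERIV_chain2[OF G logistic_deriv]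
        DERIV_chain2[OF G comp']) auto
  moreover have "phi \<rho> \<psi> 0 = (\<lambda>t. \<rho> (- ln (1 - logistic t)) + G_corr \<psi> (logistic t) + G_corr \<psi> (1 - logistic t))"
    by (auto simp: phi_def fun_eq_iff)
  ultimately show ?thesis
    by (simp add: algebra_simps)
qed

lemma abs_phi_0_bounded:
  assumes R1: "cond_R1 \<rho> \<psi>"
  shows "\<exists>C. \<forall>t. \<bar>phi \<rho> \<psi> 0 t\<bar> \<le> C"
proof -
  obtain K where K: "\<And>t. 0 \<le> t \<Longrightarrow> \<bar>\<psi> t\<bar> \<le> K"
    using R1 by (auto simp: cond_R1_def bounded_iff)
  obtain L where L: "\<And>t. 0 \<le> t \<Longrightarrow> \<bar>\<rho> t\<bar> \<le> L"
    using R1 by (auto simp: cond_R1_def bounded_iff)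
  have "\<bar>phi \<rho> \<psi> 0 t\<bar> \<le> L + K + K" for t
  proof -
    have F: "0 < logistic t" "logistic t < 1"
      by (rule logistic_pos logistic_less_1)+
    have G: "\<bar>G_corr \<psi> s\<bar> \<le> K" if "0 < s" "s < 1" for s
      by (rule abs_G_corr_le[OF _ K]) (use that R1 in \<open>auto simp: cond_R1_def\<close>)
    show ?thesis
      using L[of "- ln (1 - logistic t)"] G[of "logistic t"] G[of "1 - logistic t"] F
      by (simp add: phi_def)
  qed
  then show ?thesis by blast
qed

lemma phi_0_fisher_loss:
  assumes R1: "cond_R1 \<rho> \<psi>" and R2: "cond_R2 \<psi>" and C: "\<And>t. \<bar>phi \<rho> \<psi> 0 t\<bar> \<le> C"
  shows "fisher_loss (phi \<rho> \<psi> 0) C"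
proof -
  let ?B = "phi \<rho> \<psi> 0"
  define D where "D t = \<psi> (- ln (logistic t)) * (1 - logistic t) + \<psi> (- ln (1 - logistic t)) * logistic t" for t
  have B: "(?B has_real_derivative logistic t * D t) (at t)" for t
    unfolding D_def by (rule phi_0_deriv[OF R1])
  have F: "0 < logistic t" "logistic t < 1" for t
    by (rule logistic_pos logistic_less_1)+
  have \<psi>_nonneg: "0 \<le> \<psi> (- ln s)" if "0 < s" "s < 1" for s
    using R2 that by (simp add: cond_R2_def)
  \<comment> \<open>Here \<open>c \<ge> ln 2\<close> enters: \<open>- ln s\<close> lies below
    \<open>ln 2\<close> exactly when \<open>s\<close> exceeds \<open>1 / 2\<close>.\<close>
  have \<psi>_pos: "0 < \<psi> (- ln s)" if "1 / 2 < s" "s < 1" for s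
  proof -
    have "ln (1 / 2) < ln s"
      using that by (subst ln_less_cancel_iff) auto
    then have "- ln s < ln 2"
      by (simp add: ln_div)
    then show ?thesis
      using R2 that by (auto simp: cond_R2_def)
  qed
  have D_nonneg: "0 \<le> D t" for t
    unfolding D_def using F[of t] by (intro add_nonneg_nonneg mult_nonneg_nonneg \<psi>_nonneg) auto
  have D_minus: "D (- t) = D t" for t
    by (simp add: D_def logistic_minus)
  \<comment> \<open>For \<open>t < 0\<close> the number \<open>1 - logistic t\<close> exceeds
    \<open>1 / 2\<close>, so the second summand of \<open>D\<close> is positive. At
    \<open>t = 0\<close> both arguments of \<psi> equal \<open>ln 2\<close>, where \<psi> may
    vanish.\<close>
  have D_pos: "0 < D t" if "t < 0" for t
    using that F[of t] logistic_less_half_iff[of t] unfolding D_def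
    by (intro add_nonneg_pos mult_nonneg_nonneg mult_pos_pos \<psi>_nonneg \<psi>_pos) auto
  then have D_pos: "0 < D t" if "t \<noteq> 0" for t
    using that D_minus[of t] by (metis neg_less_0_iff_less linorder_neqE_linordered_idom)
  show ?thesis
  proof
    show cont: "continuous_on UNIV ?B"
      using B by (meson DERIV_isCont continuous_at_imp_continuous_on)
    show "mono ?B"
    proof (intro monoI DERIV_nonneg_imp_nondecreasing[of _ _ ?B])
      fix z show "\<exists>y. DERIV ?B z :> y \<and> 0 \<le> y"
        by (intro exI[of _ "logistic z * D z"] conjI B mult_nonneg_nonneg D_nonneg less_imp_le[OF F(1)])
    qed
    fix s t u :: real assume st: "s \<le> t" and tu: "t < u"
    let ?h = "\<lambda>t. logistic s * ?B (- t) + (1 - logistic s) * ?B t"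
    \<comment> \<open>After \<open>D t\<close> is pulled out by evenness, the factor is \<open>(1 -
      logistic s) * logistic t - logistic s * (1 - logistic t)\<close>, whose products
      cancel.\<close>
    have h: "(?h has_real_derivative (logistic t - logistic s) * D t) (at t)" for t
    proof -
      have "(?h has_real_derivative logistic s * (logistic (- t) * D (- t) * - 1) + (1 - logistic s) * (logistic t * D t)) (at t)"
        by (intro DERIV_add DERIV_cmult B DERIV_chain2[OF B]) (auto intro!: derivative_eq_intros)
      then show ?thesis
        by (simp add: D_minus logistic_minus algebra_simps)
    qed
    \<comment> \<open>Since \<open>D\<close> may vanish at \<open>0\<close>, strict growth is shown
      on intervals without \<open>0\<close> inside; an interval around \<open>0\<close> is cut
      there.\<close>
    have step: "?h p < ?h q" if "s \<le> p" "p < q" "0 \<notin> {p<..<q}" for p q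
    proof (rule DERIV_pos_imp_increasing_open[OF \<open>p < q\<close>])
      fix z assume "p < z" "z < q"
      then show "\<exists>y. DERIV ?h z :> y \<and> 0 < y"
        using h[of z] that D_pos[of z] logistic_strict_mono[of s z] by (intro exI conjI) auto
    next
      show "continuous_on {p..q} ?h"
        using h by (meson DERIV_isCont continuous_at_imp_continuous_on)
    qed
    show "?h t < ?h u"
    proof (cases "0 \<in> {t<..<u}")
      case True
      then show ?thesis
        using step[of t 0] step[of 0 u] st tu by force
    qed (use st tu step in auto)
  qed (rule C)
qed

section \<open>Consistency\<close>

locale logistic_sample = prob_space M
  for M :: "'a measure" +
  fixes y :: "'a \<Rightarrow> real" and x :: "'a \<Rightarrow> real ^ 'p"
    and ys :: "nat \<Rightarrow> 'a \<Rightarrow> real" and xs :: "nat \<Rightarrow> 'a \<Rightarrow> real ^ 'p"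
    and \<beta>\<^sub>0 :: "real ^ 'p"
  assumes model: "logistic_model M y x \<beta>\<^sub>0"
    and sample: "iid_copies M ys xs y x"
begin

lemma y_meas [measurable]: "y \<in> borel_measurable M"
  and x_meas [measurable]: "x \<in> borel_measurable M"
  using model by (auto simp: logistic_model_def)

text \<open>Both branches depend on \<open>x\<close> alone, so the indicator of \<open>y = 1\<close>
  may be replaced by its conditional expectation given \<open>x\<close>, which the model equates
  with \<open>logistic (x \<omega> \<bullet> \<beta>\<^sub>0)\<close>.\<close>

lemma expectation_by_label:
  fixes f g :: "real ^ 'p \<Rightarrow> real"
  assumes [measurable]: "f \<in> borel_measurable borel" "g \<in> borel_measurable borel"
    and f: "\<And>v. \<bar>f v\<bar> \<le> C" and g: "\<And>v. \<bar>g v\<bar> \<le> C"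
  shows "expectation (\<lambda>\<omega>. if y \<omega> = 1 then f (x \<omega>) else g (x \<omega>)) =
    expectation (\<lambda>\<omega>. logistic (x \<omega> \<bullet> \<beta>\<^sub>0) * f (x \<omega>) + (1 - logistic (x \<omega> \<bullet> \<beta>\<^sub>0)) * g (x \<omega>))"
proof -
  let ?F = "vimage_algebra (space M) x borel"
  let ?Y = "{\<omega> \<in> space M. y \<omega> = 1}"
  let ?d = "\<lambda>\<omega>. f (x \<omega>) - g (x \<omega>)"
  interpret sub: finite_measure_subalgebra M ?F
    by unfold_locales
      (auto simp: subalgebra_def sets_vimage_algebra2 intro!: measurable_sets)
  have [measurable]: "x \<in> borel_measurable ?F"
    by (intro measurable_vimage_algebra1) auto
  have bd: "\<bar>?d \<omega>\<bar> \<le> 2 * C" for \<omega>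
    using f[of "x \<omega>"] g[of "x \<omega>"] by linarith
  have C0: "C \<ge> 0" using f[of 0] by linarith
  have int_g: "integrable M (\<lambda>\<omega>. g (x \<omega>))"
    by (intro integrable_const_bound[of _ C]) (auto simp: g)
  have int_d: "integrable M (\<lambda>\<omega>. ?d \<omega> * indicator ?Y \<omega>)"
    by (intro integrable_const_bound[of _ "2 * C"]) (use bd C0 in \<open>auto simp: indicator_def\<close>)
  have int_l: "integrable M (\<lambda>\<omega>. ?d \<omega> * logistic (x \<omega> \<bullet> \<beta>\<^sub>0))"
  proof (intro integrable_const_bound[of _ "2 * C"])
    show "AE \<omega> in M. norm (?d \<omega> * logistic (x \<omega> \<bullet> \<beta>\<^sub>0)) \<le> 2 * C"
    proof (intro AE_I2)
      fix \<omega>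
      have "\<bar>?d \<omega>\<bar> * logistic (x \<omega> \<bullet> \<beta>\<^sub>0) \<le> 2 * C * 1"
        by (intro mult_mono bd) (use logistic_pos logistic_less_1 C0 in \<open>auto intro: less_imp_le\<close>)
      then show "norm (?d \<omega> * logistic (x \<omega> \<bullet> \<beta>\<^sub>0)) \<le> 2 * C"
        using logistic_pos[of "x \<omega> \<bullet> \<beta>\<^sub>0"] by (simp add: abs_mult)
    qed
  qed measurable
  \<comment> \<open>The case distinction is affine in the indicator, so conditioning acts on a
    single product.\<close>
  have "expectation (\<lambda>\<omega>. if y \<omega> = 1 then f (x \<omega>) else g (x \<omega>)) =
      expectation (\<lambda>\<omega>. ?d \<omega> * indicator ?Y \<omega> + g (x \<omega>))"
    by (intro Bochner_Integration.integral_cong) (auto simp: indicator_def)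
  also have "\<dots> = expectation (\<lambda>\<omega>. ?d \<omega> * indicator ?Y \<omega>) + expectation (\<lambda>\<omega>. g (x \<omega>))"
    by (intro Bochner_Integration.integral_add int_g int_d)
  also have "expectation (\<lambda>\<omega>. ?d \<omega> * indicator ?Y \<omega>) =
      expectation (\<lambda>\<omega>. ?d \<omega> * real_cond_exp M ?F (indicator ?Y) \<omega>)"
    by (rule sub.real_cond_exp_intg(2)[symmetric, OF int_d]) measurable
  also have "\<dots> = expectation (\<lambda>\<omega>. ?d \<omega> * logistic (x \<omega> \<bullet> \<beta>\<^sub>0))"
    using model by (intro integral_cong_AE) (auto simp: logistic_model_def)
  also have "\<dots> + expectation (\<lambda>\<omega>. g (x \<omega>)) =
      expectation (\<lambda>\<omega>. ?d \<omega> * logistic (x \<omega> \<bullet> \<beta>\<^sub>0) + g (x \<omega>))"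
    by (intro Bochner_Integration.integral_add[symmetric] int_g int_l)
  finally show ?thesis
    by (simp add: algebra_simps)
qed

text \<open>The images of the pairs under the one map \<open>m\<close> are independent with a common
  law, so the strong law applies; \<open>expectation_by_label\<close> evaluates the limit.\<close>

lemma average_tendsto:
  fixes f g :: "real ^ 'p \<Rightarrow> real"
  assumes [measurable]: "f \<in> borel_measurable borel" "g \<in> borel_measurable borel"
    and f: "\<And>v. \<bar>f v\<bar> \<le> C" and g: "\<And>v. \<bar>g v\<bar> \<le> C"
  shows "AE \<omega> in M. (\<lambda>n. (\<Sum>i=1..n. if ys i \<omega> = 1 then f (xs i \<omega>) else g (xs i \<omega>)) / real n)
    \<longlonglongrightarrow> expectation (\<lambda>\<omega>. logistic (x \<omega> \<bullet> \<beta>\<^sub>0) * f (x \<omega>) + (1 - logistic (x \<omega> \<bullet> \<beta>\<^sub>0)) * g (x \<omega>))"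
proof -
  define m where "m = (\<lambda>z :: real \<times> (real ^ 'p). if fst z = 1 then f (snd z) else g (snd z))"
  have m: "m \<in> borel_measurable borel"
    unfolding m_def borel_prod[symmetric] by measurable
  have pair: "(\<lambda>\<omega>. (ys i \<omega>, xs i \<omega>)) \<in> borel_measurable M" if "i \<ge> 1" for i
    using sample that unfolding iid_copies_def indep_vars_def by auto
  have pair0: "(\<lambda>\<omega>. (y \<omega>, x \<omega>)) \<in> borel_measurable M"
    by measurable
  have "AE \<omega> in M. (\<lambda>n. (\<Sum>i=1..n. m (ys i \<omega>, xs i \<omega>)) / real n) \<longlonglongrightarrow>
      expectation (\<lambda>\<omega>. m (y \<omega>, x \<omega>))"
  proof (rule slln_bounded)
    show "indep_vars (\<lambda>_. borel) (\<lambda>i \<omega>. m (ys i \<omega>, xs i \<omega>)) {1..}"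
      using sample m by (auto simp: iid_copies_def intro: indep_vars_compose2)
    show "(\<lambda>\<omega>. m (y \<omega>, x \<omega>)) \<in> borel_measurable M"
      using measurable_compose[OF pair0 m] .
    show "distr M borel (\<lambda>\<omega>. m (ys i \<omega>, xs i \<omega>)) = distr M borel (\<lambda>\<omega>. m (y \<omega>, x \<omega>))"
      if "i \<ge> 1" for i
    proof -
      have "distr (distr M borel (\<lambda>\<omega>. (ys i \<omega>, xs i \<omega>))) borel m =
          distr (distr M borel (\<lambda>\<omega>. (y \<omega>, x \<omega>))) borel m"
        using sample that by (simp add: iid_copies_def)
      then show ?thesis
        by (simp add: distr_distr[OF m pair[OF that]] distr_distr[OF m pair0] comp_def)
    qed
    show "AE \<omega> in M. \<bar>m (y \<omega>, x \<omega>)\<bar> \<le> C"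
      by (auto simp: m_def f g)
  qed
  then show ?thesis
    using expectation_by_label[OF assms] by (simp add: m_def cong: if_cong)
qed

text \<open>The model states this for \<open>y\<close>; equality of the joint laws passes it to
  every \<open>ys i\<close>, and countability of the indices gives one null set.\<close>

lemma labels_binary: "AE \<omega> in M. \<forall>i\<ge>1. ys i \<omega> \<in> {0, 1}"
proof -
  have "AE \<omega> in M. ys i \<omega> \<in> {0, 1}" if "i \<ge> 1" for i
  proof -
    have pair: "(\<lambda>\<omega>. (ys i \<omega>, xs i \<omega>)) \<in> borel_measurable M"
      using sample that unfolding iid_copies_def indep_vars_def by auto
    have pair0: "(\<lambda>\<omega>. (y \<omega>, x \<omega>)) \<in> borel_measurable M"
      by measurable
    have S: "{z \<in> space borel. fst z \<in> {0, 1}} \<in> sets (borel :: (real \<times> (real ^ 'p)) measure)"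
      unfolding borel_prod[symmetric] by measurable
    have eq: "distr M borel (\<lambda>\<omega>. (ys i \<omega>, xs i \<omega>)) = distr M borel (\<lambda>\<omega>. (y \<omega>, x \<omega>))"
      using sample that by (simp add: iid_copies_def)
    have "AE \<omega> in M. fst (y \<omega>, x \<omega>) \<in> {0, 1}"
      using model by (simp add: logistic_model_def)
    then have "AE z in distr M borel (\<lambda>\<omega>. (ys i \<omega>, xs i \<omega>)). fst z \<in> {0, 1}"
      unfolding eq by (subst AE_distr_iff[OF pair0 S])
    then show ?thesis
      using AE_distr_iff[OF pair S] by simp
  qed
  then show ?thesis
    by (auto simp: AE_all_countable)
qed

end

section \<open>Wald's argument: sets that the estimator eventually avoids\<close>

text \<open>The estimator enters only through \<open>near_min\<close>: its empirical loss exceeds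
  that of \<open>\<beta>\<^sub>0\<close> by at most \<open>P n\<close>, which tends to zero.
  \<open>P n\<close> will be the penalty at \<open>\<beta>\<^sub>0\<close>.\<close>

locale penalized_logistic = logistic_sample M y x ys xs \<beta>\<^sub>0 + fisher_loss B C
  for M :: "'a measure" and y and x :: "'a \<Rightarrow> real ^ 'p" and ys xs and \<beta>\<^sub>0 and B C +
  fixes w :: "real ^ 'p \<Rightarrow> real" and W :: real
    and P :: "nat \<Rightarrow> 'a \<Rightarrow> real" and b :: "nat \<Rightarrow> 'a \<Rightarrow> real ^ 'p"
  assumes H1: "cond_H1 M x"
    and w_meas [measurable]: "w \<in> borel_measurable borel"
    and w_nonneg: "\<And>v. 0 \<le> w v" and w_le: "\<And>v. w v \<le> W"
    and w_pos: "prob {\<omega> \<in> space M. w (x \<omega>) \<noteq> 0} > 0"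
    and near_min: "AE \<omega> in M. \<forall>n\<ge>1.
      (\<Sum>i=1..n. (if ys i \<omega> = 1 then B (- (xs i \<omega> \<bullet> b n \<omega>)) else B (xs i \<omega> \<bullet> b n \<omega>)) * w (xs i \<omega>)) / real n
      \<le> (\<Sum>i=1..n. (if ys i \<omega> = 1 then B (- (xs i \<omega> \<bullet> \<beta>\<^sub>0)) else B (xs i \<omega> \<bullet> \<beta>\<^sub>0)) * w (xs i \<omega>)) / real n + P n \<omega>"
    and P_lim: "AE \<omega> in M. (\<lambda>n. P n \<omega>) \<longlonglongrightarrow> 0"
begin

lemma B_meas [measurable]: "B \<in> borel_measurable borel"
  using cont by (rule borel_measurable_continuous_onI)

lemma weighted_bound: "\<bar>t\<bar> \<le> C \<Longrightarrow> \<bar>t * w v\<bar> \<le> C * W"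
  using w_nonneg w_le by (auto simp: abs_mult intro!: mult_mono)

text \<open>The conditional expectation, given the covariate, of the weighted loss when it is
  \<open>f\<close> under label 1 and \<open>g\<close> under label 0.\<close>

definition risk :: "real \<Rightarrow> real \<Rightarrow> 'a \<Rightarrow> real" where
  "risk f g \<omega> = (logistic (x \<omega> \<bullet> \<beta>\<^sub>0) * f + (1 - logistic (x \<omega> \<bullet> \<beta>\<^sub>0)) * g) * w (x \<omega>)"

lemma risk_bound:
  assumes "\<bar>f\<bar> \<le> C" "\<bar>g\<bar> \<le> C"
  shows "\<bar>risk f g \<omega>\<bar> \<le> C * W"
proof -
  let ?l = "logistic (x \<omega> \<bullet> \<beta>\<^sub>0)"
  have "\<bar>?l * f + (1 - ?l) * g\<bar> \<le> ?l * C + (1 - ?l) * C"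
    using assms logistic_pos[of "x \<omega> \<bullet> \<beta>\<^sub>0"] logistic_less_1[of "x \<omega> \<bullet> \<beta>\<^sub>0"]
    by (intro order.trans[OF abs_triangle_ineq] add_mono) (auto simp: abs_mult intro!: mult_left_mono)
  then show ?thesis
    unfolding risk_def by (intro weighted_bound) (simp add: algebra_simps)
qed

lemma risk_meas [measurable]:
  assumes [measurable]: "f \<in> borel_measurable M" "g \<in> borel_measurable M"
  shows "(\<lambda>\<omega>. risk (f \<omega>) (g \<omega>) \<omega>) \<in> borel_measurable M"
  unfolding risk_def by measurable

text \<open>\<open>f\<close> and \<open>g\<close> bound the loss from below uniformly over
  \<open>S\<close>. If \<open>b n \<omega>\<close> were in \<open>S\<close>, the average of these
  bounds would be at most the average at \<open>\<beta>\<^sub>0\<close> plus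
  \<open>P n \<omega>\<close>; by the strong law the limits are strictly ordered the other
  way.\<close>

lemma eventually_avoids:
  fixes f g :: "real ^ 'p \<Rightarrow> real"
  assumes [measurable]: "f \<in> borel_measurable borel" "g \<in> borel_measurable borel"
    and fC: "\<And>v. \<bar>f v\<bar> \<le> C" and gC: "\<And>v. \<bar>g v\<bar> \<le> C"
    and f: "\<And>v \<beta>. \<beta> \<in> S \<Longrightarrow> f v \<le> B (- (v \<bullet> \<beta>))"
    and g: "\<And>v \<beta>. \<beta> \<in> S \<Longrightarrow> g v \<le> B (v \<bullet> \<beta>)"
    and less: "expectation (\<lambda>\<omega>. risk (B (- (x \<omega> \<bullet> \<beta>\<^sub>0))) (B (x \<omega> \<bullet> \<beta>\<^sub>0)) \<omega>)
      < expectation (\<lambda>\<omega>. risk (f (x \<omega>)) (g (x \<omega>)) \<omega>)"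
  shows "AE \<omega> in M. \<forall>\<^sub>F n in sequentially. b n \<omega> \<notin> S"
proof -
  let ?avg = "\<lambda>f g \<omega> n.
    (\<Sum>i=1..n. if ys i \<omega> = 1 then f (xs i \<omega>) * w (xs i \<omega>) else g (xs i \<omega>) * w (xs i \<omega>)) / real n"
  let ?f_true = "\<lambda>v. B (- (v \<bullet> \<beta>\<^sub>0))" and ?g_true = "\<lambda>v. B (v \<bullet> \<beta>\<^sub>0)"
  have lim: "AE \<omega> in M. (\<lambda>n. ?avg f g \<omega> n) \<longlonglongrightarrow> expectation (\<lambda>\<omega>. risk (f (x \<omega>)) (g (x \<omega>)) \<omega>)"
    if [measurable]: "f \<in> borel_measurable borel" "g \<in> borel_measurable borel"
      and "\<And>v. \<bar>f v\<bar> \<le> C" "\<And>v. \<bar>g v\<bar> \<le> C" for f g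
  proof -
    have "expectation (\<lambda>\<omega>. risk (f (x \<omega>)) (g (x \<omega>)) \<omega>) =
      expectation (\<lambda>\<omega>. logistic (x \<omega> \<bullet> \<beta>\<^sub>0) * (f (x \<omega>) * w (x \<omega>)) + (1 - logistic (x \<omega> \<bullet> \<beta>\<^sub>0)) * (g (x \<omega>) * w (x \<omega>)))"
      by (simp add: risk_def algebra_simps)
    moreover have "(\<lambda>v. f v * w v) \<in> borel_measurable borel" "(\<lambda>v. g v * w v) \<in> borel_measurable borel"
      by measurable
    ultimately show ?thesis
      using average_tendsto[of "\<lambda>v. f v * w v" "\<lambda>v. g v * w v" "C * W"] that weighted_bound by simp
  qed
  have "AE \<omega> in M. (\<lambda>n. ?avg ?f_true ?g_true \<omega> n) \<longlonglongrightarrow> expectation (\<lambda>\<omega>. risk (?f_true (x \<omega>)) (?g_true (x \<omega>)) \<omega>)"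
    by (rule lim) (auto simp: bound)
  moreover have "AE \<omega> in M. (\<lambda>n. ?avg f g \<omega> n) \<longlonglongrightarrow> expectation (\<lambda>\<omega>. risk (f (x \<omega>)) (g (x \<omega>)) \<omega>)"
    by (rule lim) (auto intro: fC gC)
  ultimately show ?thesis
    using near_min P_lim
  proof eventually_elim
    case (elim \<omega>)
    let ?E = "expectation (\<lambda>\<omega>. risk (f (x \<omega>)) (g (x \<omega>)) \<omega>)"
      and ?E_true = "expectation (\<lambda>\<omega>. risk (?f_true (x \<omega>)) (?g_true (x \<omega>)) \<omega>)"
    have "(\<lambda>n. ?avg f g \<omega> n - (?avg ?f_true ?g_true \<omega> n + P n \<omega>)) \<longlonglongrightarrow> ?E - (?E_true + 0)"
      by (intro tendsto_diff tendsto_add elim)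
    then have "\<forall>\<^sub>F n in sequentially. 0 < ?avg f g \<omega> n - (?avg ?f_true ?g_true \<omega> n + P n \<omega>)"
      using less by (intro order_tendstoD(1)) auto
    with eventually_ge_at_top[of 1] show ?case
    proof eventually_elim
      case inner: (elim n)
      have "\<not> b n \<omega> \<in> S"
      proof
        assume "b n \<omega> \<in> S"
        then have "?avg f g \<omega> n \<le> ?avg (\<lambda>v. B (- (v \<bullet> b n \<omega>))) (\<lambda>v. B (v \<bullet> b n \<omega>)) \<omega> n"
          using f g w_nonneg by (intro divide_right_mono sum_mono) (auto intro!: mult_right_mono)
        also have "\<dots> \<le> ?avg ?f_true ?g_true \<omega> n + P n \<omega>"
          using elim(3)[rule_format, OF inner(1)] by (simp add: if_distrib[of "\<lambda>t. t * _"] cong: if_cong)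
        finally show False
          using inner(2) by linarith
      qed
      then show ?case .
    qed
  qed
qed

text \<open>By dominated convergence the expected lower bounds over \<open>S k\<close> tend to the
  expected risk of the limits \<open>F\<close> and \<open>G\<close>, which exceeds that of
  \<open>\<beta>\<^sub>0\<close>. So the bound for some \<open>k\<close> already exceeds it, and
  \<open>eventually_avoids\<close> applies to that \<open>S k\<close>.\<close>

lemma shrinking_sets_avoided:
  fixes f g :: "nat \<Rightarrow> real ^ 'p \<Rightarrow> real"
  assumes [measurable]: "\<And>k. f k \<in> borel_measurable borel" "\<And>k. g k \<in> borel_measurable borel"
    and [measurable]: "F \<in> borel_measurable M" "G \<in> borel_measurable M"
    and fC: "\<And>k v. \<bar>f k v\<bar> \<le> C" and gC: "\<And>k v. \<bar>g k v\<bar> \<le> C"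
    and f: "\<And>k v \<beta>. \<beta> \<in> S k \<Longrightarrow> f k v \<le> B (- (v \<bullet> \<beta>))"
    and g: "\<And>k v \<beta>. \<beta> \<in> S k \<Longrightarrow> g k v \<le> B (v \<bullet> \<beta>)"
    and F: "AE \<omega> in M. (\<lambda>k. f k (x \<omega>)) \<longlonglongrightarrow> F \<omega>"
    and G: "AE \<omega> in M. (\<lambda>k. g k (x \<omega>)) \<longlonglongrightarrow> G \<omega>"
    and strict: "AE \<omega> in M. logistic (x \<omega> \<bullet> \<beta>\<^sub>0) * B (- (x \<omega> \<bullet> \<beta>\<^sub>0)) + (1 - logistic (x \<omega> \<bullet> \<beta>\<^sub>0)) * B (x \<omega> \<bullet> \<beta>\<^sub>0)
      < logistic (x \<omega> \<bullet> \<beta>\<^sub>0) * F \<omega> + (1 - logistic (x \<omega> \<bullet> \<beta>\<^sub>0)) * G \<omega>"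
  shows "\<exists>k. AE \<omega> in M. \<forall>\<^sub>F n in sequentially. b n \<omega> \<notin> S k"
proof -
  let ?r_true = "\<lambda>\<omega>. risk (B (- (x \<omega> \<bullet> \<beta>\<^sub>0))) (B (x \<omega> \<bullet> \<beta>\<^sub>0)) \<omega>"
  have conv: "AE \<omega> in M. (\<lambda>k. risk (f k (x \<omega>)) (g k (x \<omega>)) \<omega>) \<longlonglongrightarrow> risk (F \<omega>) (G \<omega>) \<omega>"
    using F G by eventually_elim (auto simp: risk_def intro!: tendsto_intros)
  have dom: "AE \<omega> in M. norm (risk (f k (x \<omega>)) (g k (x \<omega>)) \<omega>) \<le> C * W" for k
    using risk_bound[OF fC gC] by simp
  have lim: "(\<lambda>k. expectation (\<lambda>\<omega>. risk (f k (x \<omega>)) (g k (x \<omega>)) \<omega>)) \<longlonglongrightarrow> expectation (\<lambda>\<omega>. risk (F \<omega>) (G \<omega>) \<omega>)"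
    by (rule integral_dominated_convergence[where w = "\<lambda>_. C * W"]) (auto intro: conv dom simp del: real_norm_def)
  have int: "integrable M (\<lambda>\<omega>. risk (F \<omega>) (G \<omega>) \<omega>)"
    by (rule integrable_dominated_convergence[where w = "\<lambda>_. C * W"]) (auto intro: conv dom simp del: real_norm_def)
  have int0: "integrable M ?r_true"
    by (rule integrable_const_bound[of _ "C * W"]) (auto intro!: risk_bound bound)
  \<comment> \<open>Multiplication by \<open>w\<close> weakens the pointwise gap to a weak
    inequality where \<open>w\<close> vanishes; it stays strict on a set of positive probability,
    which orders the integrals strictly.\<close>
  have "expectation ?r_true < expectation (\<lambda>\<omega>. risk (F \<omega>) (G \<omega>) \<omega>)"
  proof (rule integral_less_AE[OF int0 int])
    show "{\<omega> \<in> space M. w (x \<omega>) \<noteq> 0} \<in> sets M" by measurable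
    show "emeasure M {\<omega> \<in> space M. w (x \<omega>) \<noteq> 0} \<noteq> 0"
      using w_pos by (simp add: emeasure_eq_measure)
    show "AE \<omega> in M. ?r_true \<omega> \<le> risk (F \<omega>) (G \<omega>) \<omega>"
      using strict by eventually_elim (auto simp: risk_def w_nonneg intro!: mult_right_mono)
    show "AE \<omega> in M. \<omega> \<in> {\<omega> \<in> space M. w (x \<omega>) \<noteq> 0} \<longrightarrow> ?r_true \<omega> \<noteq> risk (F \<omega>) (G \<omega>) \<omega>"
      using strict by eventually_elim (auto simp: risk_def)
  qed
  then have "\<forall>\<^sub>F k in sequentially. expectation ?r_true < expectation (\<lambda>\<omega>. risk (f k (x \<omega>)) (g k (x \<omega>)) \<omega>)"
    using lim by (intro order_tendstoD(1))
  then obtain k where "expectation ?r_true < expectation (\<lambda>\<omega>. risk (f k (x \<omega>)) (g k (x \<omega>)) \<omega>)"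
    by (meson eventually_happens' sequentially_bot)
  then have "AE \<omega> in M. \<forall>\<^sub>F n in sequentially. b n \<omega> \<notin> S k"
    by (intro eventually_avoids[of "f k" "g k"] fC gC f g) auto
  then show ?thesis ..
qed

lemma AE_inner_nonzero: "a \<noteq> 0 \<Longrightarrow> AE \<omega> in M. x \<omega> \<bullet> a \<noteq> 0"
  using H1 prob_eq_0[of "{\<omega> \<in> space M. x \<omega> \<bullet> a = 0}"] by (auto simp: cond_H1_def)

text \<open>By Cauchy--Schwarz, moving \<beta> by less than \<open>r\<close> changes
  \<open>v \<bullet> \<beta>\<close> by at most \<open>r * norm v\<close>, so monotonicity of
  \<open>B\<close> gives lower bounds on the ball, and continuity their limits. The gap is strict
  because \<open>x \<omega> \<bullet> (\<beta>\<^sub>0 - \<beta>)\<close> is almost surely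
  nonzero.\<close>

lemma ball_avoided:
  assumes "\<beta> \<noteq> \<beta>\<^sub>0"
  shows "\<exists>r>0. AE \<omega> in M. \<forall>\<^sub>F n in sequentially. b n \<omega> \<notin> ball \<beta> r"
proof -
  have conv: "(\<lambda>k. B (t - s / real (Suc k))) \<longlonglongrightarrow> B t" for s t
  proof (rule continuous_on_tendsto_compose[OF cont])
    have "(\<lambda>k. t - s * inverse (real (Suc k))) \<longlonglongrightarrow> t - s * 0"
      by (intro tendsto_intros LIMSEQ_inverse_real_of_nat)
    then show "(\<lambda>k. t - s / real (Suc k)) \<longlonglongrightarrow> t"
      by (simp add: divide_inverse)
  qed auto
  have close: "\<bar>v \<bullet> \<beta>' - v \<bullet> \<beta>\<bar> \<le> norm v / real (Suc k)" if "\<beta>' \<in> ball \<beta> (1 / real (Suc k))" for v \<beta>' k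
  proof -
    have "\<bar>v \<bullet> \<beta>' - v \<bullet> \<beta>\<bar> \<le> norm v * norm (\<beta>' - \<beta>)"
      unfolding inner_diff_right[symmetric] by (rule Cauchy_Schwarz_ineq2)
    also have "\<dots> \<le> norm v * (1 / real (Suc k))"
      using that by (intro mult_left_mono) (auto simp: dist_norm norm_minus_commute)
    finally show ?thesis by simp
  qed
  have "\<exists>k. AE \<omega> in M. \<forall>\<^sub>F n in sequentially. b n \<omega> \<notin> ball \<beta> (1 / real (Suc k))"
  proof (rule shrinking_sets_avoided)
    show "AE \<omega> in M. (\<lambda>k. B (- (x \<omega> \<bullet> \<beta>) - norm (x \<omega>) / real (Suc k))) \<longlonglongrightarrow> B (- (x \<omega> \<bullet> \<beta>))"
      by (intro AE_I2 conv)
    show "AE \<omega> in M. (\<lambda>k. B (x \<omega> \<bullet> \<beta> - norm (x \<omega>) / real (Suc k))) \<longlonglongrightarrow> B (x \<omega> \<bullet> \<beta>)"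
      by (intro AE_I2 conv)
    show "AE \<omega> in M. logistic (x \<omega> \<bullet> \<beta>\<^sub>0) * B (- (x \<omega> \<bullet> \<beta>\<^sub>0)) + (1 - logistic (x \<omega> \<bullet> \<beta>\<^sub>0)) * B (x \<omega> \<bullet> \<beta>\<^sub>0)
      < logistic (x \<omega> \<bullet> \<beta>\<^sub>0) * B (- (x \<omega> \<bullet> \<beta>)) + (1 - logistic (x \<omega> \<bullet> \<beta>\<^sub>0)) * B (x \<omega> \<bullet> \<beta>)"
      using AE_inner_nonzero[of "\<beta>\<^sub>0 - \<beta>"] assms
      by (auto simp: inner_diff_right intro: risk_min elim!: eventually_mono)
  next
    fix k v \<beta>' assume "\<beta>' \<in> ball \<beta> (1 / real (Suc k))"
    from close[OF this, of v]
    show "B (- (v \<bullet> \<beta>) - norm v / real (Suc k)) \<le> B (- (v \<bullet> \<beta>'))"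
      and "B (v \<bullet> \<beta> - norm v / real (Suc k)) \<le> B (v \<bullet> \<beta>')"
      by (auto intro!: monoD[OF mono])
  qed (auto simp: bound)
  then show ?thesis
    by (metis of_nat_0_less_iff zero_less_Suc zero_less_divide_1_iff)
qed

text \<open>On the cone \<open>norm \<beta> \<ge> K\<close>, \<open>norm (sgn \<beta> - u) < 1 / K\<close> one has
  \<open>v \<bullet> \<beta> \<ge> norm \<beta> * (v \<bullet> u - norm v / K) \<ge> K * (v \<bullet> u) - norm v\<close>, provided that the last
  expression is nonnegative.\<close>

definition cone_bound :: "real ^ 'p \<Rightarrow> nat \<Rightarrow> real ^ 'p \<Rightarrow> real" where
  "cone_bound u k v =
    (if 0 \<le> real (Suc k) * (v \<bullet> u) - norm v then B (real (Suc k) * (v \<bullet> u) - norm v) else B_bot)"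

lemma cone_bound_meas [measurable]: "cone_bound u k \<in> borel_measurable borel"
  unfolding cone_bound_def by measurable

lemma abs_cone_bound_le: "\<bar>cone_bound u k v\<bar> \<le> C"
  by (simp add: cone_bound_def bound abs_B_bot_le)

lemma cone_bound_le:
  assumes "real (Suc k) \<le> norm \<beta>" "dist u (sgn \<beta>) < 1 / real (Suc k)"
  shows "cone_bound u k v \<le> B (v \<bullet> \<beta>)"
proof (cases "0 \<le> real (Suc k) * (v \<bullet> u) - norm v")
  case True
  define K where "K = real (Suc k)"
  have K: "K > 0" "K \<le> norm \<beta>" "norm (u - sgn \<beta>) \<le> 1 / K"
    using assms by (auto simp: K_def dist_norm)
  have "v \<bullet> (u - sgn \<beta>) \<le> norm v * norm (u - sgn \<beta>)"
    by (rule norm_cauchy_schwarz)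
  also have "\<dots> \<le> norm v * (1 / K)"
    by (intro mult_left_mono K) auto
  finally have sgn_ge: "v \<bullet> u - norm v / K \<le> v \<bullet> sgn \<beta>"
    by (simp add: inner_diff_right)
  have "K * (v \<bullet> u) - norm v = K * (v \<bullet> u - norm v / K)"
    using K by (simp add: field_simps)
  \<comment> \<open>Nonnegativity from the case distinction is used here: a larger factor would
    lower a negative number.\<close>
  also have "\<dots> \<le> norm \<beta> * (v \<bullet> u - norm v / K)"
    using True[folded K_def] K by (intro mult_right_mono) (auto simp: field_simps)
  also have "\<dots> \<le> norm \<beta> * (v \<bullet> sgn \<beta>)"
    by (intro mult_left_mono sgn_ge) auto
  also have "\<dots> = v \<bullet> \<beta>"
    using less_le_trans[OF K(1,2)] by (simp add: sgn_div_norm)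
  finally show ?thesis
    using True[folded K_def] monoD[OF mono] by (simp add: cone_bound_def K_def[symmetric] del: of_nat_Suc)
qed (auto simp: cone_bound_def B_bot_le)

text \<open>For \<open>v \<bullet> u > 0\<close> the argument of \<open>B\<close> grows to infinity;
  for \<open>v \<bullet> u < 0\<close> the default \<open>B_bot\<close> is taken at every
  \<open>k\<close>. A zero inner product is excluded, as \<open>u\<close> and \<open>- u\<close>
  could then both yield only \<open>B_bot\<close>.\<close>

lemma cone_bound_tendsto:
  assumes "v \<bullet> u \<noteq> 0"
  shows "(\<lambda>k. cone_bound u k v) \<longlonglongrightarrow> (if 0 < v \<bullet> u then B_top else B_bot)"
proof (cases "0 < v \<bullet> u")
  case True
  have lim: "filterlim (\<lambda>k. real (Suc k) * (v \<bullet> u) - norm v) at_top sequentially"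
    using True by real_asymp
  then have "\<forall>\<^sub>F k in sequentially. 0 \<le> real (Suc k) * (v \<bullet> u) - norm v"
    unfolding filterlim_at_top by blast
  then have "\<forall>\<^sub>F k in sequentially. B (real (Suc k) * (v \<bullet> u) - norm v) = cone_bound u k v"
    by eventually_elim (simp add: cone_bound_def)
  then show ?thesis
    using True filterlim_compose[OF tendsto_B_top lim] by (auto elim: Lim_transform_eventually)
next
  case False
  then have "real (Suc k) * (v \<bullet> u) < 0" for k
    using assms by (intro mult_pos_neg) auto
  then have "\<not> 0 \<le> real (Suc k) * (v \<bullet> u) - norm v" for k
    using norm_ge_zero[of v] by (smt (verit))
  then show ?thesis
    using False by (simp add: cone_bound_def del: of_nat_Suc)
qed

text \<open>The lower bound for one label tends to \<open>B_top\<close> and that for the other to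
  \<open>B_bot\<close>, according to the sign of \<open>x \<omega> \<bullet> u\<close>. Either way
  the limiting risk exceeds that of \<open>\<beta>\<^sub>0\<close>.\<close>

lemma cone_avoided:
  assumes "u \<noteq> 0"
  shows "\<exists>k. AE \<omega> in M. \<forall>\<^sub>F n in sequentially.
    b n \<omega> \<notin> {\<beta>. real (Suc k) \<le> norm \<beta> \<and> dist u (sgn \<beta>) < 1 / real (Suc k)}"
proof (rule shrinking_sets_avoided)
  let ?lim = "\<lambda>u \<omega>. if 0 < x \<omega> \<bullet> u then B_top else B_bot"
  have u: "AE \<omega> in M. x \<omega> \<bullet> u \<noteq> 0"
    by (rule AE_inner_nonzero) fact
  show "AE \<omega> in M. (\<lambda>k. cone_bound (- u) k (x \<omega>)) \<longlonglongrightarrow> ?lim (- u) \<omega>"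
    using u by eventually_elim (rule cone_bound_tendsto, simp)
  show "AE \<omega> in M. (\<lambda>k. cone_bound u k (x \<omega>)) \<longlonglongrightarrow> ?lim u \<omega>"
    using u by eventually_elim (rule cone_bound_tendsto, simp)
  show "AE \<omega> in M. logistic (x \<omega> \<bullet> \<beta>\<^sub>0) * B (- (x \<omega> \<bullet> \<beta>\<^sub>0)) + (1 - logistic (x \<omega> \<bullet> \<beta>\<^sub>0)) * B (x \<omega> \<bullet> \<beta>\<^sub>0)
      < logistic (x \<omega> \<bullet> \<beta>\<^sub>0) * ?lim (- u) \<omega> + (1 - logistic (x \<omega> \<bullet> \<beta>\<^sub>0)) * ?lim u \<omega>"
    using u by eventually_elim (auto simp: risk_less_risk_top risk_less_risk_bot)
next
  fix k v \<beta>
  assume *: "\<beta> \<in> {\<beta>. real (Suc k) \<le> norm \<beta> \<and> dist u (sgn \<beta>) < 1 / real (Suc k)}"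
  then show "cone_bound u k v \<le> B (v \<bullet> \<beta>)"
    by (intro cone_bound_le) auto
  \<comment> \<open>Under label 1 the loss is \<open>B (v \<bullet> (- \<beta>))\<close>, and
    \<open>- \<beta>\<close> lies in the cone around \<open>- u\<close>.\<close>
  have "dist (- u) (sgn (- \<beta>)) = dist u (sgn \<beta>)"
    by (simp add: sgn_minus dist_minus)
  with * show "cone_bound (- u) k v \<le> B (- (v \<bullet> \<beta>))"
    using cone_bound_le[of k "- \<beta>" "- u" v] by simp
qed (auto simp: abs_cone_bound_le)

section \<open>Compactness: from avoided neighbourhoods to convergence\<close>

lemma neighbourhood_of_infinity_avoided:
  "\<exists>R. AE \<omega> in M. \<forall>\<^sub>F n in sequentially. norm (b n \<omega>) < R"
proof -
  have "\<forall>u\<in>sphere 0 1. \<exists>k. AE \<omega> in M. \<forall>\<^sub>F n in sequentially.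
      b n \<omega> \<notin> {\<beta>. real (Suc k) \<le> norm \<beta> \<and> dist u (sgn \<beta>) < 1 / real (Suc k)}"
    by (intro ballI cone_avoided) auto
  from bchoice[OF this] obtain k where k: "\<forall>u\<in>sphere 0 1. AE \<omega> in M. \<forall>\<^sub>F n in sequentially.
      b n \<omega> \<notin> {\<beta>. real (Suc (k u)) \<le> norm \<beta> \<and> dist u (sgn \<beta>) < 1 / real (Suc (k u))}" ..
  have "sphere 0 1 \<subseteq> (\<Union>u\<in>sphere 0 1. ball u (1 / real (Suc (k u))))"
  proof
    fix u :: "real ^ 'p" assume "u \<in> sphere 0 1"
    moreover have "u \<in> ball u (1 / real (Suc (k u)))" by simp
    ultimately show "u \<in> (\<Union>u\<in>sphere 0 1. ball u (1 / real (Suc (k u))))" by blast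
  qed
  from compactE_image[OF compact_sphere open_ball this]
  obtain U where U: "U \<subseteq> sphere 0 1" "finite U" "sphere 0 1 \<subseteq> (\<Union>u\<in>U. ball u (1 / real (Suc (k u))))"
    by metis
  \<comment> \<open>Inserting \<open>1\<close> makes the set nonempty and \<open>R\<close> positive,
    so norm at least \<open>R\<close> excludes the zero vector, whose \<open>sgn\<close> is not on
    the sphere.\<close>
  define R where "R = Max (insert 1 ((\<lambda>u. real (Suc (k u))) ` U))"
  have R: "1 \<le> R" "u \<in> U \<Longrightarrow> real (Suc (k u)) \<le> R" for u
    unfolding R_def using U(2) by (auto intro!: Max_ge simp del: of_nat_Suc)
  have "AE \<omega> in M. \<forall>u\<in>U. \<forall>\<^sub>F n in sequentially.
      b n \<omega> \<notin> {\<beta>. real (Suc (k u)) \<le> norm \<beta> \<and> dist u (sgn \<beta>) < 1 / real (Suc (k u))}"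
    using U(1) by (intro AE_finite_allI U(2) bspec[OF k]) blast
  then have "AE \<omega> in M. \<forall>\<^sub>F n in sequentially. norm (b n \<omega>) < R"
  proof eventually_elim
    case (elim \<omega>)
    \<comment> \<open>Finiteness of \<open>U\<close> merges the thresholds in \<open>n\<close> into
      one.\<close>
    then have "\<forall>\<^sub>F n in sequentially. \<forall>u\<in>U.
        b n \<omega> \<notin> {\<beta>. real (Suc (k u)) \<le> norm \<beta> \<and> dist u (sgn \<beta>) < 1 / real (Suc (k u))}"
      by (subst eventually_ball_finite_distrib[OF U(2)])
    then show ?case
    proof eventually_elim
      case (elim n)
      show ?case
      proof (rule ccontr)
        assume "\<not> norm (b n \<omega>) < R"
        then have ge: "R \<le> norm (b n \<omega>)" by simp
        then have "sgn (b n \<omega>) \<in> sphere 0 1"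
          using R(1) by (auto simp: norm_sgn)
        then obtain u where "u \<in> U" "dist u (sgn (b n \<omega>)) < 1 / real (Suc (k u))"
          using U(3) by (auto simp del: of_nat_Suc)
        then show False
          using elim order.trans[OF R(2) ge] by blast
      qed
    qed
  qed
  then show ?thesis ..
qed

text \<open>Outside the ball around \<open>\<beta>\<^sub>0\<close> but within radius
  \<open>R\<close> the parameters form a compact set, which finitely many avoided balls
  cover.\<close>

lemma eventually_in_ball:
  assumes "\<epsilon> > 0"
  shows "AE \<omega> in M. \<forall>\<^sub>F n in sequentially. b n \<omega> \<in> ball \<beta>\<^sub>0 \<epsilon>"
proof -
  obtain R where R: "AE \<omega> in M. \<forall>\<^sub>F n in sequentially. norm (b n \<omega>) < R"
    using neighbourhood_of_infinity_avoided ..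
  have "\<forall>\<beta>\<in>cball 0 R - ball \<beta>\<^sub>0 \<epsilon>. \<exists>r>0. AE \<omega> in M. \<forall>\<^sub>F n in sequentially. b n \<omega> \<notin> ball \<beta> r"
    using assms by (intro ballI ball_avoided) auto
  then obtain r where r: "\<And>\<beta>. \<beta> \<in> cball 0 R - ball \<beta>\<^sub>0 \<epsilon> \<Longrightarrow>
      r \<beta> > 0 \<and> (AE \<omega> in M. \<forall>\<^sub>F n in sequentially. b n \<omega> \<notin> ball \<beta> (r \<beta>))"
    by metis
  have "compact (cball 0 R - ball \<beta>\<^sub>0 \<epsilon>)"
    by (intro compact_diff) auto
  then obtain U where U: "U \<subseteq> cball 0 R - ball \<beta>\<^sub>0 \<epsilon>" "finite U"
      "cball 0 R - ball \<beta>\<^sub>0 \<epsilon> \<subseteq> (\<Union>u\<in>U. ball u (r u))"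
    by (rule compactE_image[of _ "cball 0 R - ball \<beta>\<^sub>0 \<epsilon>" "\<lambda>u. ball u (r u)"]) (use r in force)+
  have "AE \<omega> in M. \<forall>u\<in>U. \<forall>\<^sub>F n in sequentially. b n \<omega> \<notin> ball u (r u)"
    using U r by (intro AE_finite_allI) auto
  with R show ?thesis
  proof eventually_elim
    case (elim \<omega>)
    then have "\<forall>\<^sub>F n in sequentially. norm (b n \<omega>) < R \<and> (\<forall>u\<in>U. b n \<omega> \<notin> ball u (r u))"
      by (simp add: eventually_conj_iff eventually_ball_finite_distrib[OF U(2)])
    then show ?case
    proof eventually_elim
      case (elim n)
      then have "b n \<omega> \<in> cball 0 R" "b n \<omega> \<notin> (\<Union>u\<in>U. ball u (r u))"
        by auto
      then show ?case
        using U(3) by blast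
    qed
  qed
qed

theorem strongly_consistent: "AE \<omega> in M. (\<lambda>n. b n \<omega>) \<longlonglongrightarrow> \<beta>\<^sub>0"
proof -
  have "AE \<omega> in M. \<forall>k. \<forall>\<^sub>F n in sequentially. b n \<omega> \<in> ball \<beta>\<^sub>0 (1 / real (Suc k))"
    by (subst AE_all_countable, intro allI eventually_in_ball) simp
  then show ?thesis
  proof eventually_elim
    case (elim \<omega>)
    show ?case
    proof (rule tendstoI)
      fix \<epsilon> :: real assume "\<epsilon> > 0"
      then obtain k where k: "1 / real (Suc k) < \<epsilon>"
        using nat_approx_posE by blast
      show "\<forall>\<^sub>F n in sequentially. dist (b n \<omega>) \<beta>\<^sub>0 < \<epsilon>"
        using elim[rule_format, of k]
        by eventually_elim (use k in \<open>auto simp: dist_commute\<close>)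
    qed
  qed
qed

end

section \<open>Reduction of the penalized estimator to the near-minimality inequality\<close>

theorem theorem4p1:
  fixes M :: "'a measure"
    and y :: "'a \<Rightarrow> real" and x :: "'a \<Rightarrow> real ^ 'p"
    and ys :: "nat \<Rightarrow> 'a \<Rightarrow> real" and xs :: "nat \<Rightarrow> 'a \<Rightarrow> real ^ 'p"
    and \<beta>\<^sub>0 :: "real ^ 'p"
    and \<rho> \<psi> :: "real \<Rightarrow> real"
    and w :: "real ^ 'p \<Rightarrow> real"
    and pen :: "'l \<Rightarrow> real ^ 'p \<Rightarrow> real"
    and lam :: "nat \<Rightarrow> 'a \<Rightarrow> 'l"
    and beta_hat :: "nat \<Rightarrow> 'a \<Rightarrow> real ^ 'p"
  assumes "prob_space M"
    and model: "logistic_model M y x \<beta>\<^sub>0"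
    and sample: "iid_copies M ys xs y x"
    and R1: "cond_R1 \<rho> \<psi>"
    and R2: "cond_R2 \<psi>"
    and H1: "cond_H1 M x"
    and H2: "cond_H2 M x w"
    and penalty_nonneg: "\<And>l \<beta>. pen l \<beta> \<ge> 0"
    and estimator: "\<And>n. n \<ge> 1 \<Longrightarrow> AE \<omega> in M.
          is_penalized_estimate \<rho> \<psi> w (pen (lam n \<omega>)) (\<lambda>i. ys i \<omega>) (\<lambda>i. xs i \<omega>) n (beta_hat n \<omega>)"
    and penalty_lim: "AE \<omega> in M. (\<lambda>n. pen (lam n \<omega>) \<beta>\<^sub>0) \<longlonglongrightarrow> 0"
  shows "AE \<omega> in M. (\<lambda>n. beta_hat n \<omega>) \<longlonglongrightarrow> \<beta>\<^sub>0"
proof -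
  let ?B = "phi \<rho> \<psi> 0"
  obtain C where C: "\<And>t. \<bar>?B t\<bar> \<le> C"
    using abs_phi_0_bounded[OF R1] by blast
  obtain W where W: "\<And>v. \<bar>w v\<bar> \<le> W"
    using H2 unfolding cond_H2_def bounded_iff by fastforce
  interpret prob_space M by fact
  interpret logistic_sample M y x ys xs \<beta>\<^sub>0
    by unfold_locales (rule model sample)+
  interpret fisher_loss ?B C
    by (rule phi_0_fisher_loss[OF R1 R2 C])
  \<comment> \<open>With labels in \<open>{0, 1}\<close>, \<open>phi_1_eq\<close> expresses every
    summand through \<open>?B\<close> at plus or minus the linear predictor.\<close>
  have emp: "emp_loss \<rho> \<psi> w (\<lambda>i. ys i \<omega>) (\<lambda>i. xs i \<omega>) n \<beta> =
      (\<Sum>i=1..n. (if ys i \<omega> = 1 then ?B (- (xs i \<omega> \<bullet> \<beta>)) else ?B (xs i \<omega> \<bullet> \<beta>)) * w (xs i \<omega>)) / real n"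
    if "\<forall>i\<ge>1. ys i \<omega> \<in> {0, 1}" for \<omega> n \<beta>
  proof -
    have "phi \<rho> \<psi> (ys i \<omega>) (xs i \<omega> \<bullet> \<beta>) = (if ys i \<omega> = 1 then ?B (- (xs i \<omega> \<bullet> \<beta>)) else ?B (xs i \<omega> \<bullet> \<beta>))"
      if "i \<in> {1..n}" for i
      using \<open>\<forall>i\<ge>1. ys i \<omega> \<in> {0, 1}\<close>[rule_format, of i] that by (auto simp: phi_1_eq)
    then show ?thesis
      unfolding emp_loss_def by simp
  qed
  interpret penalized_logistic M y x ys xs \<beta>\<^sub>0 ?B C w W "\<lambda>n \<omega>. pen (lam n \<omega>) \<beta>\<^sub>0" beta_hat
  proof
    have "AE \<omega> in M. \<forall>n\<ge>1.
        is_penalized_estimate \<rho> \<psi> w (pen (lam n \<omega>)) (\<lambda>i. ys i \<omega>) (\<lambda>i. xs i \<omega>) n (beta_hat n \<omega>)"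
      using estimator by (auto simp: AE_all_countable)
    with labels_binary show "AE \<omega> in M. \<forall>n\<ge>1.
      (\<Sum>i=1..n. (if ys i \<omega> = 1 then ?B (- (xs i \<omega> \<bullet> beta_hat n \<omega>)) else ?B (xs i \<omega> \<bullet> beta_hat n \<omega>)) * w (xs i \<omega>)) / real n
      \<le> (\<Sum>i=1..n. (if ys i \<omega> = 1 then ?B (- (xs i \<omega> \<bullet> \<beta>\<^sub>0)) else ?B (xs i \<omega> \<bullet> \<beta>\<^sub>0)) * w (xs i \<omega>)) / real n
        + pen (lam n \<omega>) \<beta>\<^sub>0"
    proof eventually_elim
      case (elim \<omega>)
      show ?case
      proof (intro allI impI)
        fix n :: nat assume "n \<ge> 1"
        let ?L = "emp_loss \<rho> \<psi> w (\<lambda>i. ys i \<omega>) (\<lambda>i. xs i \<omega>) n"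
        have "?L (beta_hat n \<omega>) + pen (lam n \<omega>) (beta_hat n \<omega>) \<le> ?L \<beta>\<^sub>0 + pen (lam n \<omega>) \<beta>\<^sub>0"
          using elim(2) \<open>n \<ge> 1\<close> by (auto simp: is_penalized_estimate_def is_arg_min_linorder)
        \<comment> \<open>The penalty at the estimate is nonnegative, so dropping it from the left
          side leaves a valid inequality in which only the vanishing penalty at
          \<open>\<beta>\<^sub>0\<close> remains.\<close>
        then have "?L (beta_hat n \<omega>) \<le> ?L \<beta>\<^sub>0 + pen (lam n \<omega>) \<beta>\<^sub>0"
          using penalty_nonneg[of "lam n \<omega>" "beta_hat n \<omega>"] by linarith
        then show "(\<Sum>i=1..n. (if ys i \<omega> = 1 then ?B (- (xs i \<omega> \<bullet> beta_hat n \<omega>)) else ?B (xs i \<omega> \<bullet> beta_hat n \<omega>)) * w (xs i \<omega>)) / real n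
          \<le> (\<Sum>i=1..n. (if ys i \<omega> = 1 then ?B (- (xs i \<omega> \<bullet> \<beta>\<^sub>0)) else ?B (xs i \<omega> \<bullet> \<beta>\<^sub>0)) * w (xs i \<omega>)) / real n
            + pen (lam n \<omega>) \<beta>\<^sub>0"
          unfolding emp[OF elim(1)] .
      qed
    qed
    show "w v \<le> W" for v
      using W[of v] by linarith
  qed (use H1 H2 penalty_lim in \<open>auto simp: cond_H2_def\<close>)
  show ?thesis
    by (rule strongly_consistent)
qed

end
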